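(* Let $a\ge 2$ be an integer and $T=T(a,a+1,a+2)$. Then the line graph $L(T)$ is transmission irregular if and only if $a$ is even.
   Context: The transmission of a vertex $v$ of a graph $G$ is ${\rm Tr}_G(v)=\sum_{u\in V(G)} d_G(u,v)$; $G$ is transmission irregular if all its vertices have pairwise different transmissions. The starlike tree $T(k_1,k_2,k_3)$ is the tree obtained by attaching to a single vertex three pendant paths of lengths $k_1,k_2,k_3$. $L(G)$ denotes the line graph of $G$. *)

theory Defs
  imports Main "HOL-Library.Extended_Nat"
begin

record 'a graph =
  verts :: "'a set"
  edges :: "'a set set"

definition simple_graph :: "'a graph \<Rightarrow> bool" where
  "simple_graph G \<longleftrightarrow> finite (verts G) \<and> (\<forall>e\<in>edges G. e \<subseteq> verts G \<and> card e = 2)"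

definition walk :: "'a graph \<Rightarrow> 'a list \<Rightarrow> bool" where
  "walk G p \<longleftrightarrow> p \<noteq> [] \<and> set p \<subseteq> verts G \<and> successively (\<lambda>x y. {x, y} \<in> edges G) p"

(* The number of edges of a walk p is length p - 1.
   The distance is infinite if no walk connects u and v, since Inf {} = \<infinity> in enat. *)
definition graph_dist :: "'a graph \<Rightarrow> 'a \<Rightarrow> 'a \<Rightarrow> enat" where
  "graph_dist G u v = (INF p \<in> {p. walk G p \<and> hd p = u \<and> last p = v}. enat (length p - 1))"

definition transmission :: "'a graph \<Rightarrow> 'a \<Rightarrow> enat" where
  "transmission G v = (\<Sum>u\<in>verts G. graph_dist G u v)"

definition transmission_irregular :: "'a graph \<Rightarrow> bool" where
  "transmission_irregular G \<longleftrightarrow>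
     (\<forall>u\<in>verts G. \<forall>v\<in>verts G. u \<noteq> v \<longrightarrow> transmission G u \<noteq> transmission G v)"

definition line_graph :: "'a graph \<Rightarrow> 'a set graph" where
  "line_graph G =
     \<lparr>verts = edges G,
      edges = {{e, f} |e f. e \<in> edges G \<and> f \<in> edges G \<and> e \<noteq> f \<and> e \<inter> f \<noteq> {}}\<rparr>"

(* Leg i j, with j \<ge> 1, is the vertex at distance j from the centre on the i-th pendant path. *)
datatype starlike_vertex = Center | Leg nat nat

definition leg_vertex :: "nat \<Rightarrow> nat \<Rightarrow> starlike_vertex" where
  "leg_vertex i j = (if j = 0 then Center else Leg i j)"

(* A pendant path of length k contributes k edges and k new vertices,
   so starlike_tree ks has sum_list ks + 1 vertices. *)
definition starlike_tree :: "nat list \<Rightarrow> starlike_vertex graph" where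
  "starlike_tree ks =
     \<lparr>verts = insert Center {Leg i j |i j. i < length ks \<and> 1 \<le> j \<and> j \<le> ks ! i},
      edges = {{leg_vertex i j, leg_vertex i (Suc j)} |i j. i < length ks \<and> j < ks ! i}\<rparr>"

lemma simple_graph_starlike_tree: "simple_graph (starlike_tree ks)"
proof -
  let ?S = "SIGMA i:{..<length ks}. {1..ks ! i}"
  have "{Leg i j |i j. i < length ks \<and> 1 \<le> j \<and> j \<le> ks ! i} = case_prod Leg ` ?S"
    by auto
  then have "finite {Leg i j |i j. i < length ks \<and> 1 \<le> j \<and> j \<le> ks ! i}"
    by simp
  then show ?thesis
    by (auto simp: simple_graph_def starlike_tree_def leg_vertex_def)
qed

lemma simple_graph_line_graph:
  assumes "simple_graph G"
  shows "simple_graph (line_graph G)"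
proof -
  have "edges G \<subseteq> Pow (verts G)" "finite (verts G)"
    using assms by (auto simp: simple_graph_def)
  then have "finite (edges G)"
    by (meson finite_Pow_iff finite_subset)
  then show ?thesis
    by (auto simp: simple_graph_def line_graph_def card_2_iff)
qed

end

theory Submission
  imports Defs
begin

text \<open>
  Number the edges of each pendant path by their distance \<open>j\<close> from the centre. In the line graph,
  edges \<open>j\<close> and \<open>j'\<close> are at distance \<open>\<bar>j - j'\<bar>\<close> on the same leg and \<open>j + j' + 1\<close> on different legs,
  so an edge \<open>j\<close> on a leg of length \<open>n\<close> has transmission \<open>j\<^sup>2 + j (N + 1 - 2 n) - n + S\<close>, where \<open>N\<close> is the
  number of edges and \<open>S\<close> depends only on the tree. For legs \<open>a\<close>, \<open>a + 1\<close>, \<open>a + 2\<close> these values are, up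
  to a common constant, \<open>A j = j\<^sup>2 + j (a + 4) + 2\<close>, \<open>B j = j\<^sup>2 + j (a + 2) + 1\<close> and \<open>C j = j\<^sup>2 + j a\<close>.
  They interlace: \<open>B k < A k < B (k + 1)\<close>, \<open>C k < B k < C (k + 1)\<close> and \<open>C k < A k < C (k + 2)\<close>. Hence the
  only possible coincidence is \<open>A k = C (k + 1)\<close>, which means \<open>2 k + 1 = a\<close>.
\<close>

section \<open>Distances certified by a potential function\<close>

text \<open>Descending from \<open>u\<close> builds a walk of length \<open>\<phi> u\<close> to
  \<open>v\<close>, and by \<open>lipschitz\<close> no walk is shorter. A distance formula thus
  needs only local checks.\<close>

lemma graph_dist_eqI:
  fixes \<phi> :: "'a \<Rightarrow> nat"
  assumes v: "v \<in> verts G" "\<phi> v = 0"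
    and lipschitz: "\<And>x y. x \<in> verts G \<Longrightarrow> y \<in> verts G \<Longrightarrow> {x, y} \<in> edges G \<Longrightarrow> \<phi> x \<le> Suc (\<phi> y)"
    and descent: "\<And>x. x \<in> verts G \<Longrightarrow> x \<noteq> v \<Longrightarrow>
      \<exists>y\<in>verts G. {x, y} \<in> edges G \<and> \<phi> x = Suc (\<phi> y)"
    and u: "u \<in> verts G"
  shows "graph_dist G u v = enat (\<phi> u)"
proof (rule antisym)
  have "\<exists>p. walk G p \<and> hd p = u \<and> last p = v \<and> length p = Suc (\<phi> u)"
    using u
  proof (induction "\<phi> u" arbitrary: u)
    case 0
    then have "u = v"
      using descent by fastforce
    then show ?case
      using v by (intro exI[of _ "[v]"]) (simp add: walk_def)
  next
    case (Suc n)
    then have "u \<noteq> v"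
      using v by auto
    then obtain y where y: "y \<in> verts G" "{u, y} \<in> edges G" "\<phi> u = Suc (\<phi> y)"
      using descent Suc.prems by blast
    then obtain p where "walk G p" "hd p = y" "last p = v" "length p = Suc (\<phi> y)"
      using Suc.hyps by auto
    then show ?case
      using y Suc.prems
      by (intro exI[of _ "u # p"]) (auto simp: walk_def successively_Cons)
  qed
  then show "graph_dist G u v \<le> enat (\<phi> u)"
    unfolding graph_dist_def by (force intro: INF_lower2)
next
  \<comment> \<open>Leaving both endpoints arbitrary lets the induction drop the first
    vertex.\<close>
  have "\<phi> (hd p) \<le> \<phi> (last p) + (length p - 1)" if "walk G p" for p
    using that
  proof (induction p)
    case (Cons x p)
    show ?case
    proof (cases p)
      case (Cons y q)
      then have "\<phi> x \<le> Suc (\<phi> y)" "walk G p"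
        using Cons.prems lipschitz by (auto simp: walk_def)
      then show ?thesis
        using Cons.IH Cons by auto
    qed simp
  qed (simp add: walk_def)
  then show "enat (\<phi> u) \<le> graph_dist G u v"
    unfolding graph_dist_def using v by (intro INF_greatest) (metis (mono_tags) add_0 enat_ord_simps(1) mem_Collect_eq)
qed

section \<open>Distances in the line graph of a starlike tree\<close>

lemma mem_edges_line_graph_iff:
  "{x, y} \<in> edges (line_graph G) \<longleftrightarrow> x \<in> edges G \<and> y \<in> edges G \<and> x \<noteq> y \<and> x \<inter> y \<noteq> {}"
  by (auto simp: line_graph_def doubleton_eq_iff)

definition leg_edge :: "nat \<times> nat \<Rightarrow> starlike_vertex set" where
  "leg_edge = (\<lambda>(i, j). {leg_vertex i j, leg_vertex i (Suc j)})"

definition leg_indices :: "nat list \<Rightarrow> (nat \<times> nat) set" where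
  "leg_indices ks = (SIGMA i:{..<length ks}. {..<ks ! i})"

text \<open>Between different legs a shortest path makes \<open>j\<close> steps inwards, one step
  between two central edges and \<open>j'\<close> steps outwards. On one leg, the two truncated
  differences add up to the absolute difference.\<close>

definition leg_edge_dist :: "nat \<times> nat \<Rightarrow> nat \<times> nat \<Rightarrow> nat" where
  "leg_edge_dist = (\<lambda>(i, j) (i', j'). if i = i' then (j - j') + (j' - j) else j + j' + 1)"

lemma inj_leg_edge: "inj leg_edge"
  by (auto simp: inj_on_def leg_edge_def leg_vertex_def doubleton_eq_iff split: if_splits)

lemma leg_edge_eq_iff [simp]: "leg_edge x = leg_edge y \<longleftrightarrow> x = y"
  using inj_leg_edge by (simp add: inj_eq)

lemma edges_starlike_tree: "edges (starlike_tree ks) = leg_edge ` leg_indices ks"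
  by (auto simp: starlike_tree_def leg_edge_def leg_indices_def)

lemma verts_line_graph_starlike_tree:
  "verts (line_graph (starlike_tree ks)) = leg_edge ` leg_indices ks"
  by (simp add: line_graph_def edges_starlike_tree)

text \<open>Different legs share only \<open>Center\<close>, which lies exactly on the edges of
  index 0.\<close>

lemma leg_edge_Int_iff:
  "leg_edge (i, j) \<inter> leg_edge (i', j') \<noteq> {} \<longleftrightarrow>
     i = i' \<and> j \<le> Suc j' \<and> j' \<le> Suc j \<or> j = 0 \<and> j' = 0"
  by (auto simp: leg_edge_def leg_vertex_def)

lemma line_graph_starlike_tree_adj_iff:
  "{leg_edge (i, j), leg_edge (i', j')} \<in> edges (line_graph (starlike_tree ks)) \<longleftrightarrow>
     (i, j) \<in> leg_indices ks \<and> (i', j') \<in> leg_indices ks \<and> (i, j) \<noteq> (i', j') \<and>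
     (i = i' \<and> j \<le> Suc j' \<and> j' \<le> Suc j \<or> j = 0 \<and> j' = 0)"
  unfolding mem_edges_line_graph_iff leg_edge_Int_iff
  by (auto simp: edges_starlike_tree image_iff)

lemma graph_dist_leg_edge:
  assumes x: "x \<in> leg_indices ks" and y: "y \<in> leg_indices ks"
  shows "graph_dist (line_graph (starlike_tree ks)) (leg_edge x) (leg_edge y) =
    enat (leg_edge_dist x y)"
proof -
  let ?G = "line_graph (starlike_tree ks)"
  let ?\<phi> = "\<lambda>e. leg_edge_dist (inv leg_edge e) y"
  note [simp] = inv_f_f[OF inj_leg_edge] verts_line_graph_starlike_tree
  obtain i' j' where y': "y = (i', j')"
    by fastforce
  have "graph_dist ?G (leg_edge x) (leg_edge y) = enat (?\<phi> (leg_edge x))"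
  proof (rule graph_dist_eqI)
    show "leg_edge y \<in> verts ?G" "leg_edge x \<in> verts ?G" "?\<phi> (leg_edge y) = 0"
      using x y by (auto simp: y' leg_edge_dist_def)
  next
    fix e f
    assume e: "e \<in> verts ?G" and f: "f \<in> verts ?G" and ef: "{e, f} \<in> edges ?G"
    obtain i j where "e = leg_edge (i, j)"
      using e by auto
    moreover obtain k l where "f = leg_edge (k, l)"
      using f by auto
    ultimately show "?\<phi> e \<le> Suc (?\<phi> f)"
      using ef by (auto simp: y' line_graph_starlike_tree_adj_iff leg_edge_dist_def)
  next
    fix e
    assume e: "e \<in> verts ?G" "e \<noteq> leg_edge y"
    then obtain i j where ij: "e = leg_edge (i, j)" "(i, j) \<in> leg_indices ks" "(i, j) \<noteq> (i', j')"
      by (auto simp: y')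
    \<comment> \<open>The next edge on a shortest path to \<open>y\<close>: outwards if
      \<open>y\<close> lies further out on the same leg, across to the leg of \<open>y\<close> at
      the centre, and inwards otherwise.\<close>
    define z where "z =
      (if i = i' \<and> j < j' then (i, Suc j) else if j = 0 then (i', 0) else (i, j - 1))"
    have "z \<in> leg_indices ks"
      using ij y by (auto simp: z_def y' leg_indices_def)
    moreover from this have "{e, leg_edge z} \<in> edges ?G"
      using ij by (auto simp: z_def line_graph_starlike_tree_adj_iff)
    moreover have "leg_edge_dist (i, j) y = Suc (leg_edge_dist z y)"
      using ij by (auto simp: z_def y' leg_edge_dist_def)
    ultimately show "\<exists>f\<in>verts ?G. {e, f} \<in> edges ?G \<and> ?\<phi> e = Suc (?\<phi> f)"
      using ij by auto
  qed
  then show ?thesis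
    by simp
qed

section \<open>Transmissions in closed form\<close>

definition leg_edge_transmission :: "nat list \<Rightarrow> nat \<times> nat \<Rightarrow> nat" where
  "leg_edge_transmission ks y = (\<Sum>x\<in>leg_indices ks. leg_edge_dist x y)"

lemma transmission_leg_edge:
  assumes "y \<in> leg_indices ks"
  shows "transmission (line_graph (starlike_tree ks)) (leg_edge y) =
    enat (leg_edge_transmission ks y)"
proof -
  have "transmission (line_graph (starlike_tree ks)) (leg_edge y) =
      (\<Sum>x\<in>leg_indices ks. graph_dist (line_graph (starlike_tree ks)) (leg_edge x) (leg_edge y))"
    unfolding transmission_def verts_line_graph_starlike_tree
    by (rule sum.reindex_cong[of leg_edge]) (auto intro: inj_on_subset[OF inj_leg_edge])
  also have "\<dots> = (\<Sum>x\<in>leg_indices ks. enat (leg_edge_dist x y))"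
    using assms by (intro sum.cong) (auto simp: graph_dist_leg_edge)
  also have "\<dots> = enat (leg_edge_transmission ks y)"
    \<comment> \<open>Read as \<open>of_nat\<close>, \<open>enat\<close> commutes with the
      sum.\<close>
    unfolding leg_edge_transmission_def of_nat_eq_enat[symmetric] by simp
  finally show ?thesis .
qed

lemma transmission_irregular_line_graph_starlike_tree_iff:
  "transmission_irregular (line_graph (starlike_tree ks)) \<longleftrightarrow>
     inj_on (leg_edge_transmission ks) (leg_indices ks)"
  by (auto simp: transmission_irregular_def verts_line_graph_starlike_tree
      transmission_leg_edge inj_on_def)

text \<open>Induction on \<open>n\<close> from \<open>j\<close> upwards: each new term
  \<open>n - j\<close> grows both sides by \<open>Suc n\<close>. Negative terms stand on the left to
  avoid truncated subtraction.\<close>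

lemma sum_abs_diff_lessThan:
  fixes j n :: nat
  assumes "j \<le> n"
  shows "(\<Sum>l<n. (l - j) + (j - l)) + n + n * j = j\<^sup>2 + j + (\<Sum>l<n. Suc l)"
  using assms
proof (induction n rule: dec_induct)
  case base
  \<comment> \<open>Reversing the order of summation.\<close>
  have "(\<Sum>l<j. j - l) = (\<Sum>l<j. Suc l)"
    using sum.nat_diff_reindex[of Suc j] by (simp add: Suc_diff_Suc)
  then show ?case
    by (simp add: power2_eq_square)
next
  case (step n)
  then show ?case
    by (simp add: algebra_simps)
qed

text \<open>Another leg \<open>k\<close> contributes \<open>ks ! k * j + S k\<close>; the own leg is
  covered by \<open>sum_abs_diff_lessThan\<close>.\<close>

lemma leg_edge_transmission_eq:
  assumes "(i, j) \<in> leg_indices ks"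
  shows "leg_edge_transmission ks (i, j) + ks ! i + 2 * (ks ! i) * j =
    j\<^sup>2 + j * (sum_list ks + 1) + (\<Sum>i'<length ks. \<Sum>l<ks ! i'. Suc l)"
proof -
  define D where "D k = (\<Sum>l<ks ! k. leg_edge_dist (k, l) (i, j))" for k
  define S where "S k = (\<Sum>l<ks ! k. Suc l)" for k
  have i: "i < length ks" and j: "j < ks ! i"
    using assms by (auto simp: leg_indices_def)
  have "D k = ks ! k * j + S k" if "k \<noteq> i" for k
    using that sum.distrib[of "\<lambda>_. j" Suc "{..<ks ! k}"]
    by (simp add: D_def S_def leg_edge_dist_def add.commute)
  then have other: "(\<Sum>k\<in>{..<length ks} - {i}. D k) = (\<Sum>k\<in>{..<length ks} - {i}. ks ! k * j + S k)"
    by (intro sum.cong) auto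
  have own: "D i + ks ! i + ks ! i * j = j\<^sup>2 + j + S i"
    using sum_abs_diff_lessThan[of j "ks ! i"] j by (simp add: D_def S_def leg_edge_dist_def)
  have "leg_edge_transmission ks (i, j) = (\<Sum>k<length ks. D k)"
    by (simp add: leg_edge_transmission_def leg_indices_def D_def sum.Sigma)
  also have "\<dots> = D i + (\<Sum>k\<in>{..<length ks} - {i}. ks ! k * j + S k)"
    using i by (simp add: sum.remove[of _ i D] other)
  \<comment> \<open>A second \<open>ks ! i * j\<close> on both sides gives the own leg the same term
    as the others, so that the sum extends over all legs.\<close>
  finally have "leg_edge_transmission ks (i, j) + ks ! i + 2 * (ks ! i) * j =
      j\<^sup>2 + j + (ks ! i * j + S i + (\<Sum>k\<in>{..<length ks} - {i}. ks ! k * j + S k))"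
    using own by (simp add: algebra_simps)
  also have "ks ! i * j + S i + (\<Sum>k\<in>{..<length ks} - {i}. ks ! k * j + S k) =
      (\<Sum>k<length ks. ks ! k * j + S k)"
    using i by (simp add: sum.remove[of "{..<length ks}" i])
  also have "\<dots> = sum_list ks * j + (\<Sum>k<length ks. S k)"
    by (simp add: sum.distrib sum_distrib_right sum_list_sum_nth atLeast0LessThan)
  finally show ?thesis
    by (simp add: S_def algebra_simps)
qed

section \<open>Coincidences between three legs of consecutive lengths\<close>

text \<open>For \<open>i = 0, 1, 2\<close> these are the polynomials \<open>A\<close>,
  \<open>B\<close>, \<open>C\<close>. The linear coefficient is
  \<open>(3 * a + 4) - 2 * (a + i)\<close>, and \<open>2 - i\<close> is \<open>- (a + i)\<close>
  shifted by \<open>a + 2\<close>.\<close>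

definition leg_score :: "nat \<Rightarrow> nat \<times> nat \<Rightarrow> nat" where
  "leg_score a = (\<lambda>(i, j). j\<^sup>2 + j * (a + 4 - 2 * i) + (2 - i))"

lemma leg_indices_consecutive:
  "leg_indices [a, a + 1, a + 2] = (SIGMA i:{..<3}. {..<a + i})"
  by (auto simp: leg_indices_def less_Suc_eq numeral_3_eq_3)

lemma leg_edge_transmission_eq_leg_score:
  fixes a :: nat
  defines "ks \<equiv> [a, a + 1, a + 2]"
  assumes "x \<in> leg_indices ks"
  shows "leg_edge_transmission ks x + a + 2 =
    leg_score a x + (\<Sum>i'<length ks. \<Sum>l<ks ! i'. Suc l)"
proof -
  define S where "S = (\<Sum>i'<length ks. \<Sum>l<ks ! i'. Suc l)"
  obtain i j where x: "x = (i, j)"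
    by fastforce
  then have "i \<in> {..<3}"
    using assms unfolding ks_def leg_indices_consecutive by blast
  then have i: "i = 0 \<or> i = 1 \<or> i = 2"
    by auto
  then have "ks ! i = a + i" "sum_list ks + 1 = 3 * a + 4"
    by (auto simp: ks_def)
  then have "leg_edge_transmission ks x + (a + i) + 2 * (a + i) * j = j\<^sup>2 + j * (3 * a + 4) + S"
    using leg_edge_transmission_eq[of i j ks] assms by (simp only: x S_def)
  then have "leg_edge_transmission ks x + a + 2 = leg_score a x + S"
    using i by (elim disjE) (simp_all add: x leg_score_def algebra_simps)
  then show ?thesis
    by (simp only: S_def)
qed

lemma leg_score_strict_mono:
  assumes "a > 0" "i < 3" "j < l"
  shows "leg_score a (i, j) < leg_score a (i, l)"
proof -
  have "j\<^sup>2 < l\<^sup>2" "j * (a + 4 - 2 * i) \<le> l * (a + 4 - 2 * i)"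
    using assms by (auto intro: power_strict_mono mult_right_mono)
  then show ?thesis
    by (simp add: leg_score_def add_less_le_mono del: mult_le_cancel2)
qed

text \<open>The score lies strictly between two consecutive values on the next leg, which is
  strictly increasing.\<close>

lemma leg_score_neq_Suc:
  assumes "a > 0" "i < 2"
  shows "leg_score a (i, j) \<noteq> leg_score a (Suc i, l)"
proof -
  have i: "i = 0 \<or> i = 1"
    using assms by auto
  then have "leg_score a (Suc i, j) < leg_score a (i, j)"
    by (auto simp: leg_score_def algebra_simps)
  \<comment> \<open>The gap is \<open>a + 2\<close> for \<open>i = 0\<close> and \<open>a\<close>
    for \<open>i = 1\<close>.\<close>
  moreover have "leg_score a (i, j) < leg_score a (Suc i, Suc j)"
    using i assms by (auto simp: leg_score_def algebra_simps power2_eq_square)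
  ultimately show ?thesis
    using leg_score_strict_mono[of a "Suc i" l j] leg_score_strict_mono[of a "Suc i" "Suc j" l]
      assms by (cases l j rule: linorder_cases; cases "l = Suc j") auto
qed

text \<open>Two legs apart, the bounds \<open>j\<close> and \<open>j + 2\<close> leave just the
  middle index \<open>Suc j\<close> for a coincidence.\<close>

lemma leg_score_0_eq_2_iff:
  assumes "a > 0"
  shows "leg_score a (0, j) = leg_score a (2, l) \<longleftrightarrow> l = Suc j \<and> a = 2 * j + 1"
proof -
  have between: "leg_score a (2, j) < leg_score a (0, j)" "leg_score a (0, j) < leg_score a (2, j + 2)"
    using assms by (auto simp: leg_score_def algebra_simps power2_eq_square)
  have mono: "leg_score a (2, l) < leg_score a (2, j)" if "l < j"
    using assms that by (simp add: leg_score_strict_mono)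
  have mono': "leg_score a (2, j + 2) < leg_score a (2, l)" if "j + 2 < l"
    using assms that by (simp add: leg_score_strict_mono)
  \<comment> \<open>Over the integers, the right score minus the left one is
    \<open>a - (2 * j + 1)\<close>.\<close>
  have "leg_score a (0, j) = leg_score a (2, Suc j) \<longleftrightarrow> a = 2 * j + 1"
    by (auto simp: leg_score_def algebra_simps power2_eq_square)
  moreover have "leg_score a (0, j) \<noteq> leg_score a (2, l)" if "l \<noteq> Suc j"
  proof -
    have "l = j \<or> l < j \<or> l = j + 2 \<or> j + 2 < l"
      using that by linarith
    then show ?thesis
      using between mono mono' by (elim disjE) simp_all
  qed
  ultimately show ?thesis
    by blast
qed

lemma inj_on_leg_score_iff:
  assumes "a > 0"
  shows "inj_on (leg_score a) (SIGMA i:{..<3}. {..<a + i}) \<longleftrightarrow> even a"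
proof
  assume inj: "inj_on (leg_score a) (SIGMA i:{..<3}. {..<a + i})"
  show "even a"
  proof (rule ccontr)
    assume "odd a"
    then obtain k where k: "a = 2 * k + 1"
      by (rule oddE)
    then have "leg_score a (0, k) = leg_score a (2, Suc k)"
      using assms by (simp add: leg_score_0_eq_2_iff)
    \<comment> \<open>Both legs are long enough to contain the colliding edges: \<open>k < a\<close>
      and \<open>Suc k < a + 2\<close>.\<close>
    moreover have "(0, k) \<in> (SIGMA i:{..<3}. {..<a + i})" "(2, Suc k) \<in> (SIGMA i:{..<3}. {..<a + i})"
      using k by (simp_all)
    ultimately show False
      using inj by (fastforce dest: inj_onD)
  qed
next
  assume a: "even a"
  have neq: "leg_score a (i, j) \<noteq> leg_score a (k, l)" if "i < k" "k < 3" for i j k l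
  proof -
    have "i < 2 \<and> k = Suc i \<or> i = 0 \<and> k = 2"
      using that by arith
    then consider "i < 2" "k = Suc i" | "i = 0" "k = 2"
      by blast
    then show ?thesis
    proof cases
      case 1
      then show ?thesis
        using leg_score_neq_Suc assms by simp
    next
      case 2
      then show ?thesis
        using a assms by (auto simp: leg_score_0_eq_2_iff)
    qed
  qed
  show "inj_on (leg_score a) (SIGMA i:{..<3}. {..<a + i})"
  proof (rule inj_onI)
    fix x y
    assume mem: "x \<in> (SIGMA i:{..<3}. {..<a + i})" "y \<in> (SIGMA i:{..<3}. {..<a + i})"
      and eq: "leg_score a x = leg_score a y"
    obtain i j k l where x: "x = (i, j)" and y: "y = (k, l)"
      by fastforce
    have "i < 3" "k < 3"
      using mem by (simp_all add: x y)
    then have "i = k"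
      using eq neq[of i k j l] neq[of k i l j] by (cases i k rule: linorder_cases) (auto simp: x y)
    moreover from this have "j = l"
      using eq leg_score_strict_mono[of a i j l] leg_score_strict_mono[of a i l j] \<open>i < 3\<close> assms
      by (cases j l rule: linorder_cases) (auto simp: x y)
    ultimately show "x = y"
      by (simp add: x y)
  qed
qed

theorem theorem4p2:
  fixes a :: nat
  assumes "a \<ge> 2"
  shows "transmission_irregular (line_graph (starlike_tree [a, a + 1, a + 2])) \<longleftrightarrow> even a"
proof -
  \<comment> \<open>Transmission and score differ by the same constant for \<open>x\<close> and
    \<open>y\<close>, which cancels.\<close>
  have "leg_edge_transmission [a, a + 1, a + 2] x = leg_edge_transmission [a, a + 1, a + 2] y \<longleftrightarrow>
      leg_score a x = leg_score a y"
    if "x \<in> leg_indices [a, a + 1, a + 2]" "y \<in> leg_indices [a, a + 1, a + 2]" for x y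
    using that[THEN leg_edge_transmission_eq_leg_score] by linarith
  then have "inj_on (leg_edge_transmission [a, a + 1, a + 2]) (leg_indices [a, a + 1, a + 2]) \<longleftrightarrow>
      inj_on (leg_score a) (leg_indices [a, a + 1, a + 2])"
    unfolding inj_on_def by blast
  then show ?thesis
    using assms inj_on_leg_score_iff[of a]
    unfolding transmission_irregular_line_graph_starlike_tree_iff leg_indices_consecutive by simp
qed

end
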